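(* Let $I\subset\mathbb{S}^2$ be the set of isosceles shapes in the shape sphere of labelled planar triangles (a union of great circles), equipped with the probability measure given by normalized arc length. Then $$\mathrm{Prob}(\text{Obtuse}\mid\text{Isosceles}) = \frac{1}{3},$$ and, complementarily, $\mathrm{Prob}(\text{Acute}\mid\text{Isosceles}) = \frac{2}{3}$.
   Context: A labelled triangle is an ordered triple $(q_1,q_2,q_3)$ of points of $\mathbb{R}^2$, not all three equal. Its shape is its equivalence class under translations, rotations and positive dilations (vertices are labelled; mirror images are not identified). Relative Jacobi coordinates: $R_1 = q_3 - q_2$ and $R_2 = q_1 - \tfrac12(q_2+q_3)$. Mass-weighted relative Jacobi coordinates: $\vec\rho_1 = \sqrt{1/2}\,R_1$ and $\vec\rho_2 = \sqrt{2/3}\,R_2$, with magnitudes $\rho_1,\rho_2$. The shape sphere is the unit sphere $\mathbb{S}^2\subset\mathbb{R}^3$ with its standard round metric. Shapes are identified with its points by the bijection sending the shape of $(q_1,q_2,q_3)$ to $$(X,Y,Z) = \frac{\left(2\,\vec\rho_1\cdot\vec\rho_2,\; 2(\vec\rho_1\times\vec\rho_2)_3,\; \rho_1^2-\rho_2^2\right)}{\rho_1^2+\rho_2^2},$$ where $(\vec a\times\vec b)_3 = a_1b_2-a_2b_1$. A shape is isosceles with apex $q_i$ if $q_i$ is equidistant from the other two vertices, i.e. the vector from the midpoint of the opposite side to $q_i$ is orthogonal to that side (for $i=1$: $\vec\rho_1\cdot\vec\rho_2=0$, the great circle $X=0$). $I$ is the union of the three great circles so obtained for $i=1,2,3$.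 Normalized arc length on $I$ means arc length divided by the total length of $I$. $\mathrm{Prob}(P\mid\text{Isosceles})$ is the normalized arc length of the set of shapes in $I$ with property $P$. A non-collinear triangle is obtuse if one of its interior angles is strictly greater than $\pi/2$, and acute if all its interior angles are strictly less than $\pi/2$. Collinear and right-angled shapes are finitely many on $I$, hence negligible. *)

theory Defs
  imports "HOL-Analysis.Analysis"
begin

text \<open>A triangle is its vector of vertices. The index type \<open>3\<close> is arithmetic modulo 3, so the
  vertices other than \<open>q $ i\<close> are \<open>q $ (i + 1)\<close> and \<open>q $ (i + 2)\<close>.\<close>

type_synonym triangle = "(real^2)^3"

definition labelled_triangles :: "triangle set" where
  "labelled_triangles = {q. \<not> (q $ 1 = q $ 2 \<and> q $ 2 = q $ 3)}"

definition same_shape :: "triangle rel" where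
  "same_shape = {(q, q'). q \<in> labelled_triangles \<and> q' \<in> labelled_triangles \<and>
     (\<exists>(c::real) (Q::real^2^2) (b::real^2). 0 < c \<and> rotation_matrix Q \<and>
        (\<forall>i. q' $ i = c *\<^sub>R (Q *v (q $ i)) + b))}"

type_synonym shape = "triangle set"

definition shapes :: "shape set" where
  "shapes = labelled_triangles // same_shape"

definition jacobi1 :: "triangle \<Rightarrow> real^2" where
  "jacobi1 q = sqrt (1/2) *\<^sub>R (q $ 3 - q $ 2)"

definition jacobi2 :: "triangle \<Rightarrow> real^2" where
  "jacobi2 q = sqrt (2/3) *\<^sub>R (q $ 1 - (1/2) *\<^sub>R (q $ 2 + q $ 3))"

definition shape_coords :: "triangle \<Rightarrow> real^3" where
  "shape_coords q = (let r1 = jacobi1 q; r2 = jacobi2 q in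
     (1 / ((norm r1)\<^sup>2 + (norm r2)\<^sup>2)) *\<^sub>R
       vector [2 * (r1 \<bullet> r2),
               2 * (r1 $ 1 * r2 $ 2 - r1 $ 2 * r2 $ 1),
               (norm r1)\<^sup>2 - (norm r2)\<^sup>2])"

text \<open>The coordinates are constant on each shape, so the image below is a singleton.\<close>

definition shape_point :: "shape \<Rightarrow> real^3" where
  "shape_point s = the_elem (shape_coords ` s)"

text \<open>These properties of triangles are invariant under \<open>same_shape\<close>; a shape has such a property
  if and only if some (equivalently, every) representative has it.\<close>

definition isosceles_with_apex :: "3 \<Rightarrow> triangle \<Rightarrow> bool" where
  "isosceles_with_apex i q \<longleftrightarrow> dist (q $ i) (q $ (i + 1)) = dist (q $ i) (q $ (i + 2))"

definition interior_angle :: "triangle \<Rightarrow> 3 \<Rightarrow> real" where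
  "interior_angle q i = (let a = q $ (i + 1) - q $ i; b = q $ (i + 2) - q $ i in
     arccos ((a \<bullet> b) / (norm a * norm b)))"

definition collinear_triangle :: "triangle \<Rightarrow> bool" where
  "collinear_triangle q \<longleftrightarrow> collinear {q $ 1, q $ 2, q $ 3}"

definition obtuse_triangle :: "triangle \<Rightarrow> bool" where
  "obtuse_triangle q \<longleftrightarrow> \<not> collinear_triangle q \<and> (\<exists>i. interior_angle q i > pi / 2)"

definition acute_triangle :: "triangle \<Rightarrow> bool" where
  "acute_triangle q \<longleftrightarrow> \<not> collinear_triangle q \<and> (\<forall>i. interior_angle q i < pi / 2)"

definition obtuse :: "shape \<Rightarrow> bool" where
  "obtuse s \<longleftrightarrow> (\<exists>q\<in>s. obtuse_triangle q)"

definition acute :: "shape \<Rightarrow> bool" where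
  "acute s \<longleftrightarrow> (\<exists>q\<in>s. acute_triangle q)"

definition isosceles_circle :: "3 \<Rightarrow> (real^3) set" where
  "isosceles_circle i = shape_point ` {s \<in> shapes. \<exists>q\<in>s. isosceles_with_apex i q}"

definition isosceles_set :: "(real^3) set" where
  "isosceles_set = (\<Union>i. isosceles_circle i)"

definition great_circle_param :: "real^3 \<Rightarrow> real^3 \<Rightarrow> real \<Rightarrow> real^3" where
  "great_circle_param u v t = cos t *\<^sub>R u + sin t *\<^sub>R v"

definition great_circle_frame :: "(real^3) set \<Rightarrow> (real^3) \<times> (real^3) \<Rightarrow> bool" where
  "great_circle_frame C = (\<lambda>(u, v). norm u = 1 \<and> norm v = 1 \<and> u \<bullet> v = 0 \<and>
     C = range (great_circle_param u v))"

text \<open>The arc length of the part of \<open>A\<close> lying on the great circle \<open>C\<close>, measured in a unit-speed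
  parametrisation that traverses \<open>C\<close> once. The choice of frame is immaterial: the parametrisations
  given by two orthonormal frames of the same plane differ by \<open>t \<mapsto> a \<plusminus> t\<close> (modulo \<open>2 * pi\<close>).\<close>

definition circle_arc_length :: "(real^3) set \<Rightarrow> (real^3) set \<Rightarrow> real" where
  "circle_arc_length C A = (let (u, v) = (SOME f. great_circle_frame C f) in
     measure lebesgue {t \<in> {0..<2 * pi}. great_circle_param u v t \<in> A})"

text \<open>The arc length of \<open>A \<inter> isosceles_set\<close>: the union of the three circles is cut into disjoint
  pieces, so that the points in which the circles meet are not counted repeatedly.\<close>

definition isosceles_arc_length :: "(real^3) set \<Rightarrow> real" where
  "isosceles_arc_length A =
     circle_arc_length (isosceles_circle 1) A +
     circle_arc_length (isosceles_circle 2) (A - isosceles_circle 1) +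
     circle_arc_length (isosceles_circle 3) (A - (isosceles_circle 1 \<union> isosceles_circle 2))"

definition prob_given_isosceles :: "(shape \<Rightarrow> bool) \<Rightarrow> real" where
  "prob_given_isosceles P =
     isosceles_arc_length (shape_point ` {s \<in> shapes. P s} \<inter> isosceles_set) /
     isosceles_arc_length isosceles_set"

end

theory Submission
  imports Defs
begin

text \<open>
  Put the vectors \<open>side_axis i\<close> at 120 degrees from one another in the plane \<open>Y = 0\<close>. Up to the
  factor \<open>inertia q\<close>, the squared side opposite to vertex \<open>i\<close> is \<open>1 + side_axis i \<bullet> P\<close>, where \<open>P\<close> is the
  point of the shape sphere (\<open>side_sq\<close>). The rest of the argument is symmetric in the three
  vertices. By the law of cosines and because the three axes sum to zero, the angle at vertex \<open>i\<close> is
  obtuse iff \<open>side_axis i \<bullet> P > 1 / 2\<close> (\<open>angle_compare\<close>); the triangle is collinear iff \<open>P\<close> lies on the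
  equator \<open>Y = 0\<close> (\<open>collinear_iff\<close>); and it is isosceles with apex \<open>i\<close> iff the other two axes
  have the same inner product with \<open>P\<close> (\<open>isosceles_circle_eq\<close>).

  So the circle of apex \<open>i\<close> passes through \<open>side_axis i\<close> and the pole \<open>axis 2 1\<close>. With
  \<open>c = side_axis i \<bullet> P\<close>, the other two inner products on it are \<open>- c / 2 \<le> 1 / 2\<close>, whence only the apex
  angle can be obtuse, and it is so iff \<open>c > 1 / 2\<close>. In an arc length parameter measured from
  \<open>side_axis i\<close> the value \<open>c\<close> is \<open>cos t\<close>, and \<open>cos t > 1 / 2\<close> holds on \<open>\<bar>t\<bar> < pi / 3\<close>, a third of
  the circle. The collinear and right-angled shapes and the points where the three circles meet all
  have \<open>c\<close> in \<open>{-1, 0, 1 / 2, 1}\<close>, which is a null set of parameters, so the three circles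
  contribute equally (\<open>isosceles_arc_length_eq\<close>).
\<close>

section \<open>Arc length on a great circle in terms of the cosine\<close>

lemma measure_disjoint_Un:
  assumes "A \<in> fmeasurable M" "B \<in> fmeasurable M" "A \<inter> B = {}"
  shows "measure M (A \<union> B) = measure M A + measure M B"
  using measure_Un3[OF assms(1,2)] assms(3) by simp

lemma periodic_measure_shift_aux:
  fixes p b :: real
  assumes meas: "{t. Q t} \<in> sets lebesgue"
    and per: "\<And>t. Q (t + p) = Q t" and b: "0 \<le> b" "b \<le> p"
  shows "measure lebesgue {t \<in> {b..<b + p}. Q t} = measure lebesgue {t \<in> {0..<p}. Q t}"
proof -
  have fm: "{t \<in> {x..<y}. Q t} \<in> lmeasurable" for x y :: real
  proof -
    have "{x..<y} \<inter> {t. Q t} \<in> lmeasurable"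
      by (rule fmeasurable_Int_fmeasurable[OF _ meas]) (rule bounded_set_imp_lmeasurable, auto)
    then show ?thesis by (simp add: Int_def)
  qed
  have split: "measure lebesgue {t \<in> {x..<z}. Q t} =
      measure lebesgue {t \<in> {x..<y}. Q t} + measure lebesgue {t \<in> {y..<z}. Q t}"
    if "x \<le> y" "y \<le> z" for x y z
  proof -
    have "{t \<in> {x..<z}. Q t} = {t \<in> {x..<y}. Q t} \<union> {t \<in> {y..<z}. Q t}"
      using that by auto
    moreover have "measure lebesgue ({t \<in> {x..<y}. Q t} \<union> {t \<in> {y..<z}. Q t}) =
      measure lebesgue {t \<in> {x..<y}. Q t} + measure lebesgue {t \<in> {y..<z}. Q t}"
      by (intro measure_disjoint_Un fm) auto
    ultimately show ?thesis by simp
  qed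
  \<comment> \<open>Moving the window from \<open>0\<close> to \<open>b\<close> trades \<open>[0, b)\<close> for its translate by one period.\<close>
  have "{t \<in> {p..<b + p}. Q t} = (+) p ` {t \<in> {0..<b}. Q t}"
  proof (intro set_eqI iffI)
    fix t assume "t \<in> {t \<in> {p..<b + p}. Q t}"
    then have "t - p \<in> {t \<in> {0..<b}. Q t}" using per[of "t - p"] by auto
    then show "t \<in> (+) p ` {t \<in> {0..<b}. Q t}" by (intro image_eqI[of _ _ "t - p"]) auto
  next
    fix t assume "t \<in> (+) p ` {t \<in> {0..<b}. Q t}"
    then show "t \<in> {t \<in> {p..<b + p}. Q t}" using per by (auto simp: add.commute)
  qed
  then have "measure lebesgue {t \<in> {p..<b + p}. Q t} = measure lebesgue {t \<in> {0..<b}. Q t}"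
    by (simp add: measure_translation)
  then show ?thesis using split[of b p "b + p"] split[of 0 b p] b by simp
qed

lemma periodic_measure_shift:
  fixes p b :: real
  assumes "0 < p" and meas: "{t. Q t} \<in> sets lebesgue" and per: "\<And>t. Q (t + p) = Q t"
  shows "measure lebesgue {t \<in> {b..<b + p}. Q t} = measure lebesgue {t \<in> {0..<p}. Q t}"
proof -
  define k where "k = \<lfloor>b / p\<rfloor>"
  define r where "r = b - of_int k * p"
  have perk: "Q (t + of_int j * p) = Q t" for t and j :: int
  proof (induction j arbitrary: t rule: int_induct[where k = 0])
    case (step1 i)
    then show ?case using per[of "t + of_int i * p"] by (simp add: algebra_simps)
  next
    case (step2 i)
    then show ?case using per[of "t + of_int i * p - p"] by (simp add: algebra_simps)
  qed simp
  have r: "0 \<le> r" "r \<le> p"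
  proof -
    have "of_int k \<le> b / p" "b / p < of_int k + 1" unfolding k_def by linarith+
    then show "0 \<le> r" "r \<le> p" using \<open>0 < p\<close> by (auto simp: r_def field_simps)
  qed
  have "{t \<in> {b..<b + p}. Q t} = (+) (of_int k * p) ` {t \<in> {r..<r + p}. Q t}"
  proof (intro set_eqI iffI)
    fix t assume "t \<in> {t \<in> {b..<b + p}. Q t}"
    then show "t \<in> (+) (of_int k * p) ` {t \<in> {r..<r + p}. Q t}"
      using perk[of "t - of_int k * p" k]
      by (intro image_eqI[of _ _ "t - of_int k * p"]) (auto simp: r_def)
  next
    fix t assume "t \<in> (+) (of_int k * p) ` {t \<in> {r..<r + p}. Q t}"
    then show "t \<in> {t \<in> {b..<b + p}. Q t}" using perk by (auto simp: r_def add.commute)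
  qed
  then have "measure lebesgue {t \<in> {b..<b + p}. Q t} = measure lebesgue {t \<in> {r..<r + p}. Q t}"
    by (simp add: measure_translation)
  then show ?thesis using periodic_measure_shift_aux[of Q p r, OF meas per r] by simp
qed

lemma countable_cos_eq: "countable {t. cos (t - a) = (k::real)}"
proof (cases "\<exists>t. cos (t - a) = k")
  case True
  then obtain s where s: "cos (s - a) = k" by blast
  have "{t. cos (t - a) = k} \<subseteq>
      (\<lambda>n. s + 2 * of_int n * pi) ` UNIV \<union> (\<lambda>n. 2 * a - s + 2 * of_int n * pi) ` (UNIV :: int set)"
  proof
    fix t assume "t \<in> {t. cos (t - a) = k}"
    then have "cos (t - a) = cos (s - a)" using s by simp
    then obtain n :: real where "n \<in> \<int>"
      "t - a = s - a + 2 * n * pi \<or> t - a = - (s - a) + 2 * n * pi"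
      unfolding cos_eq by blast
    then obtain m :: int where
      "t = s + 2 * of_int m * pi \<or> t = 2 * a - s + 2 * of_int m * pi"
      by (auto elim!: Ints_cases simp: algebra_simps)
    then show "t \<in> (\<lambda>n. s + 2 * of_int n * pi) ` UNIV \<union>
      (\<lambda>n. 2 * a - s + 2 * of_int n * pi) ` (UNIV :: int set)"
      by blast
  qed
  then show ?thesis by (rule countable_subset) auto
qed simp

text \<open>The definition of arc length picks an unknown orthonormal frame of the circle. A point \<open>n\<close> on
  the circle has some parameter \<open>a\<close> in that frame, and then the inner product of \<open>n\<close> with the point
  at parameter \<open>t\<close> is \<open>cos (t - a)\<close>, whatever the frame and its orientation. A set described by this
  inner product therefore has an arc length that periodicity makes independent of \<open>a\<close>. The finite
  exceptional set \<open>F\<close> absorbs the points where the description fails.\<close>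

lemma circle_arc_length_eq:
  assumes frame: "great_circle_frame C f" and n: "n \<in> C"
    and "finite F"
    and Q: "{c. Q c} \<in> sets borel"
    and S: "\<And>P. P \<in> C \<Longrightarrow> n \<bullet> P \<notin> F \<Longrightarrow> P \<in> S \<longleftrightarrow> Q (n \<bullet> P)"
  shows "circle_arc_length C S = measure lebesgue {t \<in> {-pi..<pi}. Q (cos t)}"
proof -
  obtain u v where uv: "(SOME f. great_circle_frame C f) = (u, v)" by fastforce
  have "great_circle_frame C (u, v)" using someI[of "great_circle_frame C", OF frame] uv by simp
  then have orth: "norm u = 1" "norm v = 1" "u \<bullet> v = 0" and C: "C = range (great_circle_param u v)"
    by (auto simp: great_circle_frame_def)
  obtain a where a: "n = great_circle_param u v a" using n C by auto
  have inner: "n \<bullet> great_circle_param u v t = cos (t - a)" for t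
    using orth by (simp add: a great_circle_param_def inner_simps cos_diff inner_commute
        flip: power2_norm_eq_inner)
  define N where "N = (\<Union>k\<in>F. {t. cos (t - a) = k})"
  have N: "negligible N"
    unfolding N_def using \<open>finite F\<close>
    by (intro negligible_Union) (auto simp: negligible_iff_null_sets
        intro!: null_sets_completionI countable_imp_null_set_lborel countable_cos_eq)
  have meas: "{t. Q (cos (t - b))} \<in> sets lebesgue" for b
  proof -
    have "(\<lambda>t. cos (t - b)) \<in> borel_measurable borel" by measurable
    from measurable_sets[OF this Q] have "{t. Q (cos (t - b))} \<in> sets borel"
      by (simp add: vimage_def)
    then show ?thesis by simp
  qed
  have "circle_arc_length C S = measure lebesgue {t \<in> {0..<2 * pi}. great_circle_param u v t \<in> S}"
    by (simp add: circle_arc_length_def uv)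
  also have "\<dots> = measure lebesgue {t \<in> {0..<2 * pi}. Q (cos (t - a))}"
  proof (rule measure_negligible_symdiff)
    have "{0..<2 * pi} \<inter> {t. Q (cos (t - a))} \<in> lmeasurable"
      by (rule fmeasurable_Int_fmeasurable[OF _ meas]) (rule bounded_set_imp_lmeasurable, auto)
    then show "{t \<in> {0..<2 * pi}. Q (cos (t - a))} \<in> lmeasurable"
      by (simp add: Int_def)
    have "great_circle_param u v t \<in> S \<longleftrightarrow> Q (cos (t - a))" if "t \<notin> N" for t
      using S[of "great_circle_param u v t"] that by (auto simp: C inner N_def)
    then show "negligible ({t \<in> {0..<2 * pi}. Q (cos (t - a))} -
        {t \<in> {0..<2 * pi}. great_circle_param u v t \<in> S} \<union>
        ({t \<in> {0..<2 * pi}. great_circle_param u v t \<in> S} -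
         {t \<in> {0..<2 * pi}. Q (cos (t - a))}))"
      by (intro negligible_subset[OF N]) blast
  qed
  also have "\<dots> = measure lebesgue {t \<in> {a - pi..<a - pi + 2 * pi}. Q (cos (t - a))}"
  proof (rule periodic_measure_shift[symmetric])
    show "Q (cos (t + 2 * pi - a)) = Q (cos (t - a))" for t
      using cos_periodic[of "t - a"] by (simp add: algebra_simps)
  qed (use meas in auto)
  also have "{t \<in> {a - pi..<a - pi + 2 * pi}. Q (cos (t - a))} =
      (+) a ` {t \<in> {-pi..<pi}. Q (cos t)}"
  proof (intro set_eqI iffI)
    fix t assume "t \<in> {t \<in> {a - pi..<a - pi + 2 * pi}. Q (cos (t - a))}"
    then show "t \<in> (+) a ` {t \<in> {-pi..<pi}. Q (cos t)}"
      by (intro image_eqI[of _ _ "t - a"]) auto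
  qed auto
  also have "measure lebesgue \<dots> = measure lebesgue {t \<in> {-pi..<pi}. Q (cos t)}"
    by (rule measure_translation)
  finally show ?thesis .
qed

lemma cos_gt_half_iff:
  assumes "t \<in> {-pi..pi}"
  shows "1 / 2 < cos t \<longleftrightarrow> \<bar>t\<bar> < pi / 3"
  using cos_mono_less_eq[of "pi / 3" "\<bar>t\<bar>"] assms by (auto simp: cos_60)

lemma measure_cos_gt_half: "measure lebesgue {t \<in> {-pi..<pi}. 1 / 2 < cos t} = 2 * pi / 3"
proof -
  have "{t \<in> {-pi..<pi}. 1 / 2 < cos t} = {-(pi / 3)<..<pi / 3}"
    using cos_gt_half_iff by (auto simp: abs_less_iff)
  then show ?thesis by simp
qed

lemma cos_lt_half_iff:
  assumes "t \<in> {-pi..pi}"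
  shows "cos t < 1 / 2 \<longleftrightarrow> pi / 3 < \<bar>t\<bar>"
  using cos_mono_less_eq[of "\<bar>t\<bar>" "pi / 3"] assms by (auto simp: cos_60)

lemma measure_cos_lt_half: "measure lebesgue {t \<in> {-pi..<pi}. cos t < 1 / 2} = 4 * pi / 3"
proof -
  have "{t \<in> {-pi..<pi}. cos t < 1 / 2} = {-pi..<-(pi / 3)} \<union> {pi / 3<..<pi}"
    using cos_lt_half_iff pi_gt_zero by (auto simp: abs_real_def split: if_splits)
  moreover have "measure lebesgue ({-pi..<-(pi / 3)} \<union> {pi / 3<..<pi}) =
      measure lebesgue {-pi..<-(pi / 3)} + measure lebesgue {pi / 3<..<pi}"
    by (intro measure_disjoint_Un bounded_set_imp_lmeasurable) auto
  ultimately show ?thesis by simp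
qed

section \<open>Shapes and their coordinates\<close>

definition cross2 :: "real^2 \<Rightarrow> real^2 \<Rightarrow> real" where
  "cross2 a b = a $ 1 * b $ 2 - a $ 2 * b $ 1"

text \<open>The moment of inertia about the centre of mass, for unit masses.\<close>

definition inertia :: "triangle \<Rightarrow> real" where
  "inertia q = (norm (jacobi1 q))\<^sup>2 + (norm (jacobi2 q))\<^sup>2"

lemma shape_coords_inertia:
  "shape_coords q = (1 / inertia q) *\<^sub>R
     vector [2 * (jacobi1 q \<bullet> jacobi2 q), 2 * cross2 (jacobi1 q) (jacobi2 q),
             (norm (jacobi1 q))\<^sup>2 - (norm (jacobi2 q))\<^sup>2]"
  by (simp add: shape_coords_def Let_def inertia_def cross2_def)

lemma shape_coords_components:
  "shape_coords q $ 1 = 2 * (jacobi1 q \<bullet> jacobi2 q) / inertia q"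
  "shape_coords q $ 2 = 2 * cross2 (jacobi1 q) (jacobi2 q) / inertia q"
  "shape_coords q $ 3 = ((norm (jacobi1 q))\<^sup>2 - (norm (jacobi2 q))\<^sup>2) / inertia q"
  by (simp_all add: shape_coords_inertia)

lemma inertia_pos:
  assumes "q \<in> labelled_triangles"
  shows "0 < inertia q"
proof (rule ccontr)
  assume "\<not> 0 < inertia q"
  then have "(norm (jacobi1 q))\<^sup>2 = 0" "(norm (jacobi2 q))\<^sup>2 = 0"
    unfolding inertia_def using zero_le_power2[of "norm (jacobi1 q)"] zero_le_power2[of "norm (jacobi2 q)"]
    by linarith+
  then have "q $ 3 = q $ 2" "q $ 1 = (1/2) *\<^sub>R (q $ 2 + q $ 3)"
    by (auto simp: jacobi1_def jacobi2_def)
  then have "q $ 3 = q $ 2" "q $ 1 = q $ 2"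
    by (simp_all add: scaleR_2[symmetric])
  then show False using assms by (simp add: labelled_triangles_def)
qed

text \<open>Lagrange's identity. It puts the shape coordinates on the unit sphere, and it turns the equality
  case of Cauchy-Schwarz into the vanishing of the cross product.\<close>

lemma cross2_sq: "(cross2 a b)\<^sup>2 = (norm a)\<^sup>2 * (norm b)\<^sup>2 - (a \<bullet> b)\<^sup>2"
  unfolding cross2_def power2_norm_eq_inner by (simp add: inner_vec_def sum_2) algebra

lemma norm_shape_coords:
  assumes "q \<in> labelled_triangles"
  shows "norm (shape_coords q) = 1"
proof -
  let ?a = "jacobi1 q" and ?b = "jacobi2 q"
  have "(norm (shape_coords q))\<^sup>2 =
    ((2 * (?a \<bullet> ?b))\<^sup>2 + 4 * (cross2 ?a ?b)\<^sup>2 + ((norm ?a)\<^sup>2 - (norm ?b)\<^sup>2)\<^sup>2) / (inertia q)\<^sup>2"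
    unfolding power2_norm_eq_inner[of "shape_coords q"]
    by (simp add: inner_vec_def sum_3 shape_coords_components power2_eq_square add_divide_distrib)
  also have "(2 * (?a \<bullet> ?b))\<^sup>2 + 4 * (cross2 ?a ?b)\<^sup>2 + ((norm ?a)\<^sup>2 - (norm ?b)\<^sup>2)\<^sup>2 = (inertia q)\<^sup>2"
    unfolding cross2_sq inertia_def by algebra
  also have "(inertia q)\<^sup>2 / (inertia q)\<^sup>2 = 1"
    using inertia_pos[OF assms] by simp
  finally show ?thesis using power2_eq_1_iff norm_ge_zero by (metis not_one_le_zero neg_0_le_iff_le)
qed

text \<open>Translations cancel in the Jacobi vectors; a rotation by \<open>Q\<close> preserves inner products and
  multiplies \<open>cross2\<close> by \<open>det Q = 1\<close>; a dilation by \<open>c\<close> gives the common factor \<open>c\<^sup>2\<close> in numerators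
  and denominator.\<close>

lemma shape_coords_invariant:
  assumes "(q, q') \<in> same_shape"
  shows "shape_coords q' = shape_coords q"
proof -
  obtain c :: real and Q :: "real^2^2" and b :: "real^2"
    where c: "0 < c" and Q: "rotation_matrix Q" and q': "\<And>i. q' $ i = c *\<^sub>R (Q *v (q $ i)) + b"
    using assms by (auto simp: same_shape_def)
  have j1: "jacobi1 q' = c *\<^sub>R (Q *v jacobi1 q)"
    by (simp add: jacobi1_def q' matrix_vector_mult_diff_distrib matrix_vector_mult_scaleR
        scaleR_diff_right mult.commute)
  have "(1/2) *\<^sub>R (b + b) = b" by (simp add: scaleR_2[symmetric])
  then have j2: "jacobi2 q' = c *\<^sub>R (Q *v jacobi2 q)"
    by (simp add: jacobi2_def q' matrix_vector_mult_diff_distrib matrix_vector_mult_scaleR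
        matrix_vector_right_distrib algebra_simps)
  have ot: "orthogonal_transformation ((*v) Q)" and det: "det Q = 1"
    using Q by (auto simp: rotation_matrix_def orthogonal_transformation_matrix)
  have inn: "(Q *v x) \<bullet> (Q *v y) = x \<bullet> y" for x y
    using ot by (simp add: orthogonal_transformation_def)
  have cr: "cross2 (Q *v x) (Q *v y) = cross2 x y" for x y
  proof -
    have "cross2 (Q *v x) (Q *v y) = det Q * cross2 x y"
      by (simp add: cross2_def det_2 matrix_vector_mult_def sum_2 algebra_simps)
    then show ?thesis by (simp add: det)
  qed
  have nrm: "norm (Q *v x) = norm x" for x
    using ot by (rule orthogonal_transformation_norm)
  have crs: "cross2 (c *\<^sub>R x) (c *\<^sub>R y) = c\<^sup>2 * cross2 x y" for x y
    by (simp add: cross2_def power2_eq_square algebra_simps)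
  have in': "inertia q' = c\<^sup>2 * inertia q"
    by (simp add: inertia_def j1 j2 nrm power_mult_distrib algebra_simps)
  show ?thesis
    using c by (simp add: vec_eq_iff forall_3 shape_coords_components j1 j2 nrm crs cr inn in' power_mult_distrib
        flip: right_diff_distrib) (simp add: power2_eq_square)
qed

lemma same_shape_refl:
  assumes "q \<in> labelled_triangles"
  shows "(q, q) \<in> same_shape"
proof -
  have "rotation_matrix (mat 1 :: real^2^2)" "\<forall>i. q $ i = 1 *\<^sub>R (mat 1 *v (q $ i)) + 0"
    by (simp_all add: rotation_matrix_def orthogonal_matrix_id)
  then show ?thesis using assms zero_less_one unfolding same_shape_def by blast
qed

text \<open>This replaces shapes by triangles: both sides ask for one representative that satisfies \<open>\<Phi>\<close>,
  and the coordinates do not depend on the representative.\<close>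

lemma shape_point_image:
  "shape_point ` {s \<in> shapes. \<exists>q\<in>s. \<Phi> q} = shape_coords ` {q \<in> labelled_triangles. \<Phi> q}"
proof -
  have point: "shape_point s = shape_coords q" "q \<in> labelled_triangles"
    if s_q: "s \<in> shapes" "q \<in> s" for s q
  proof -
    obtain q0 where s: "s = same_shape `` {q0}" "q0 \<in> labelled_triangles"
      using s_q by (auto simp: shapes_def elim: quotientE)
    then have "shape_coords ` s = {shape_coords q}"
      using s_q shape_coords_invariant by fastforce
    then show "shape_point s = shape_coords q" by (simp add: shape_point_def)
    show "q \<in> labelled_triangles" using s_q s by (auto simp: same_shape_def)
  qed
  show ?thesis
  proof (intro equalityI subsetI)
    fix P assume "P \<in> shape_point ` {s \<in> shapes. \<exists>q\<in>s. \<Phi> q}"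
    then show "P \<in> shape_coords ` {q \<in> labelled_triangles. \<Phi> q}" using point by blast
  next
    fix P assume "P \<in> shape_coords ` {q \<in> labelled_triangles. \<Phi> q}"
    then obtain q where q: "q \<in> labelled_triangles" "\<Phi> q" "P = shape_coords q" by blast
    have "same_shape `` {q} \<in> shapes" "q \<in> same_shape `` {q}"
      using q same_shape_refl by (auto simp: shapes_def intro: quotientI)
    then show "P \<in> shape_point ` {s \<in> shapes. \<exists>q\<in>s. \<Phi> q}"
      using q point(1) by (intro image_eqI[of _ _ "same_shape `` {q}"]) auto
  qed
qed

text \<open>A section of the Hopf map: away from the point \<open>Z = -1\<close>, where the side \<open>q $ 3 - q $ 2\<close>
  degenerates, the first Jacobi vector can be taken along the first coordinate axis.\<close>

lemma shape_coords_surj: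
  fixes P :: "real^3"
  assumes "norm P = 1"
  obtains q where "q \<in> labelled_triangles" "shape_coords q = P"
proof -
  have sq: "(P $ 1)\<^sup>2 + (P $ 2)\<^sup>2 + (P $ 3)\<^sup>2 = 1"
    using assms power2_norm_eq_inner[of P] by (simp add: inner_vec_def sum_3 power2_eq_square)
  define r1 :: "real^2" where "r1 = (if P $ 3 = -1 then 0 else vector [1 + P $ 3, 0])"
  define r2 :: "real^2" where "r2 = (if P $ 3 = -1 then vector [1, 0] else vector [P $ 1, P $ 2])"
  define q :: triangle where
    "q = vector [sqrt (3/2) *\<^sub>R r2, - sqrt (1/2) *\<^sub>R r1, sqrt (1/2) *\<^sub>R r1]"
  have "sqrt (1/2) * (2 * sqrt (1/2)) = 1"
    by (simp add: mult.left_commute[of _ 2] del: real_sqrt_divide)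
  then have j1: "jacobi1 q = r1"
    by (simp add: jacobi1_def q_def scaleR_right_distrib flip: scaleR_2)
  have j2: "jacobi2 q = r2"
    by (simp add: jacobi2_def q_def flip: real_sqrt_mult)
  show ?thesis
  proof (cases "P $ 3 = -1")
    case True
    then have "(P $ 1)\<^sup>2 + (P $ 2)\<^sup>2 = 0" using sq by simp
    then have "P $ 1 = 0" "P $ 2 = 0" by (simp_all add: sum_power2_eq_zero_iff)
    with True have coords: "shape_coords q = P"
      by (simp add: vec_eq_iff forall_3 shape_coords_components inertia_def j1 j2 r1_def r2_def
          cross2_def power2_norm_eq_inner inner_vec_def sum_2)
    have "jacobi2 q \<noteq> 0"
      using True by (auto simp: j2 r2_def vec_eq_iff forall_2)
    moreover have "jacobi2 q = 0" if "q \<notin> labelled_triangles"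
      using that by (simp add: labelled_triangles_def jacobi2_def flip: scaleR_2)
    ultimately show ?thesis using coords that by blast
  next
    case False
    have r2: "(norm r2)\<^sup>2 = (1 + P $ 3) * (1 - P $ 3)"
      using False sq by (simp add: r2_def power2_norm_eq_inner inner_vec_def sum_2) algebra
    have r1: "(norm r1)\<^sup>2 = (1 + P $ 3)\<^sup>2"
      using False by (simp add: r1_def power2_norm_eq_inner inner_vec_def sum_2) (simp add: power2_eq_square)
    have I: "inertia q = 2 * (1 + P $ 3)"
      unfolding inertia_def j1 j2 r1 r2 by algebra
    have D: "(norm r1)\<^sup>2 - (norm r2)\<^sup>2 = P $ 3 * (2 * (1 + P $ 3))"
      unfolding r1 r2 by algebra
    have nz: "1 + P $ 3 \<noteq> 0" using False by simp
    have cancel: "2 * ((1 + P $ 3) * x) / (2 + 2 * P $ 3) = x" for x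
    proof -
      have "2 + 2 * P $ 3 \<noteq> 0" using nz by linarith
      then show ?thesis by (simp add: field_simps)
    qed
    have coords: "shape_coords q = P"
      unfolding vec_eq_iff forall_3 shape_coords_components I unfolding j1 j2 D using nz False
      by (simp add: r1_def r2_def cross2_def inner_vec_def sum_2 cancel)
    have "jacobi1 q \<noteq> 0"
      using nz False by (auto simp: j1 r1_def vec_eq_iff forall_2)
    moreover have "jacobi1 q = 0" if "q \<notin> labelled_triangles"
      using that by (simp add: labelled_triangles_def jacobi1_def)
    ultimately show ?thesis using coords that by blast
  qed
qed

section \<open>Side lengths and angles on the shape sphere\<close>

text \<open>The opposite \<open>- side_axis i\<close> is the shape in which the two vertices other than \<open>i\<close> collide.\<close>

definition side_axis :: "3 \<Rightarrow> real^3" where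
  "side_axis i = (if i = 1 then vector [0, 0, 1]
     else if i = 2 then vector [- sqrt 3 / 2, 0, - 1 / 2]
     else vector [sqrt 3 / 2, 0, - 1 / 2])"

lemma three_cycle [simp]:
  "(3::3) + 1 = 1" "(3::3) + 2 = 2" "(2::3) + 2 = 1" "(2::3) + 1 = 3" "(1::3) + 1 = 2" "(1::3) + 2 = 3"
  "(4::3) = 1" "(5::3) = 2"
  by simp_all

text \<open>Each side is a fixed linear combination of the two Jacobi vectors. Its squared norm is thus
  a combination of \<open>(norm (jacobi1 q))\<^sup>2\<close>, \<open>(norm (jacobi2 q))\<^sup>2\<close> and the inner product, that is, of
  the inertia and the coordinates \<open>Z\<close> and \<open>X\<close>. The mass weights are what makes the three resulting
  axes unit vectors at equal angles, so that no vertex is special from here on.\<close>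

lemma side_sq:
  assumes "q \<in> labelled_triangles"
  shows "(norm (q $ (i + 1) - q $ (i + 2)))\<^sup>2 = inertia q * (1 + side_axis i \<bullet> shape_coords q)"
proof -
  let ?a = "jacobi1 q" and ?b = "jacobi2 q" and ?I = "inertia q"
  have coords: "?I * shape_coords q $ 1 = 2 * (?a \<bullet> ?b)"
     "?I * shape_coords q $ 3 = (norm ?a)\<^sup>2 - (norm ?b)\<^sup>2"
    unfolding shape_coords_components using inertia_pos[OF assms] by auto
  have s: "sqrt 2 *\<^sub>R ?a = q $ 3 - q $ 2" "sqrt (3/2) *\<^sub>R ?b = q $ 1 - (1/2) *\<^sub>R (q $ 2 + q $ 3)"
    by (simp_all add: jacobi1_def jacobi2_def flip: real_sqrt_mult)
  have s32: "sqrt (3/2) * sqrt 2 = sqrt 3" by (simp flip: real_sqrt_mult)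
  have e1: "q $ 2 - q $ 3 = - sqrt 2 *\<^sub>R ?a"
    using s by simp
  have e2: "q $ 3 - q $ 1 = (sqrt 2 / 2) *\<^sub>R ?a - sqrt (3/2) *\<^sub>R ?b"
  proof -
    have "(sqrt 2 / 2) *\<^sub>R ?a = (1/2) *\<^sub>R (q $ 3 - q $ 2)" unfolding s(1)[symmetric] by simp
    then show ?thesis unfolding s(2) by (simp only:) (simp add: vec_eq_iff field_simps)
  qed
  have e3: "q $ 1 - q $ 2 = (sqrt 2 / 2) *\<^sub>R ?a + sqrt (3/2) *\<^sub>R ?b"
  proof -
    have "(sqrt 2 / 2) *\<^sub>R ?a = (1/2) *\<^sub>R (q $ 3 - q $ 2)" unfolding s(1)[symmetric] by simp
    then show ?thesis unfolding s(2) by (simp only:) (simp add: vec_eq_iff field_simps)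
  qed
  have lin: "(norm (x *\<^sub>R ?a + y *\<^sub>R ?b))\<^sup>2 = x\<^sup>2 * (norm ?a)\<^sup>2 + 2 * x * y * (?a \<bullet> ?b) + y\<^sup>2 * (norm ?b)\<^sup>2" for x y
    unfolding power2_norm_eq_inner by (simp add: inner_simps inner_commute) algebra
  consider "i = 1" | "i = 2" | "i = 3" using exhaust_3 by blast
  then show ?thesis
  proof cases
    case 1
    have "(norm (q $ 2 - q $ 3))\<^sup>2 = 2 * (norm ?a)\<^sup>2" unfolding e1 by (simp add: power_mult_distrib)
    also have "\<dots> = ?I + ?I * shape_coords q $ 3" unfolding coords unfolding inertia_def by simp
    finally show ?thesis
      by (simp add: 1 side_axis_def inner_vec_def sum_3 distrib_left)
  next
    case 2
    have "(norm (q $ 3 - q $ 1))\<^sup>2 = (norm ?a)\<^sup>2 / 2 - sqrt 3 * (?a \<bullet> ?b) + 3 / 2 * (norm ?b)\<^sup>2"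
      using lin[of "sqrt 2 / 2" "- sqrt (3/2)"] s32 unfolding e2
      by (simp add: power_divide mult.commute)
    also have "\<dots> = ?I - sqrt 3 / 2 * (?I * shape_coords q $ 1) - 1 / 2 * (?I * shape_coords q $ 3)"
      unfolding coords unfolding inertia_def by (simp add: field_simps)
    finally show ?thesis
      by (simp add: 2 side_axis_def inner_vec_def sum_3 algebra_simps)
  next
    case 3
    have "(norm (q $ 1 - q $ 2))\<^sup>2 = (norm ?a)\<^sup>2 / 2 + sqrt 3 * (?a \<bullet> ?b) + 3 / 2 * (norm ?b)\<^sup>2"
      using lin[of "sqrt 2 / 2" "sqrt (3/2)"] s32 unfolding e3
      by (simp add: power_divide mult.commute)
    also have "\<dots> = ?I + sqrt 3 / 2 * (?I * shape_coords q $ 1) - 1 / 2 * (?I * shape_coords q $ 3)"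
      unfolding coords unfolding inertia_def by (simp add: field_simps)
    finally show ?thesis
      by (simp add: 3 side_axis_def inner_vec_def sum_3 algebra_simps)
  qed
qed

lemma side_axis_sum: "side_axis i + side_axis (i + 1) + side_axis (i + 2) = 0"
  using exhaust_3[of i] by (auto simp: side_axis_def vec_eq_iff forall_3)

lemma inner_side_axis: "side_axis i \<bullet> side_axis j = (if i = j then 1 else - 1 / 2)"
  using exhaust_3[of i] exhaust_3[of j] by (auto simp: side_axis_def inner_vec_def sum_3)

lemma cross2_diff_eq_0_iff:
  "cross2 (q $ 1 - q $ 2) (q $ 3 - q $ 2) = 0 \<longleftrightarrow> cross2 (jacobi1 q) (jacobi2 q) = 0"
proof -
  have "cross2 (jacobi1 q) (jacobi2 q) =
     - (sqrt (1/2) * sqrt (2/3)) * cross2 (q $ 1 - q $ 2) (q $ 3 - q $ 2)"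
    by (simp add: jacobi1_def jacobi2_def cross2_def field_simps)
  then show ?thesis by simp
qed

lemma collinear_iff:
  assumes "q \<in> labelled_triangles"
  shows "collinear_triangle q \<longleftrightarrow> shape_coords q $ 2 = 0"
proof -
  let ?x = "q $ 1 - q $ 2" and ?y = "q $ 3 - q $ 2"
  have "collinear_triangle q \<longleftrightarrow> collinear {0, ?x, ?y}"
    unfolding collinear_triangle_def by (subst collinear_3) auto
  also have "\<dots> \<longleftrightarrow> \<bar>?x \<bullet> ?y\<bar> = norm ?x * norm ?y"
    by (rule norm_cauchy_schwarz_equal[symmetric])
  also have "\<dots> \<longleftrightarrow> (?x \<bullet> ?y)\<^sup>2 = (norm ?x * norm ?y)\<^sup>2"
    using abs_eq_iff[of "?x \<bullet> ?y" "norm ?x * norm ?y"] unfolding power2_eq_iff by (simp add: abs_mult)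
  also have "\<dots> \<longleftrightarrow> (cross2 ?x ?y)\<^sup>2 = 0" unfolding cross2_sq by (auto simp: power_mult_distrib)
  also have "\<dots> \<longleftrightarrow> shape_coords q $ 2 = 0"
    using cross2_diff_eq_0_iff inertia_pos[OF assms] by (simp add: shape_coords_components)
  finally show ?thesis .
qed

text \<open>The law of cosines applied to \<open>side_sq\<close>; \<open>side_axis_sum\<close> eliminates the two adjacent sides.\<close>

lemma inner_at_vertex:
  assumes "q \<in> labelled_triangles"
  shows "(q $ (i + 1) - q $ i) \<bullet> (q $ (i + 2) - q $ i) =
     inertia q * (1 / 2 - side_axis i \<bullet> shape_coords q)"
proof -
  let ?a = "q $ (i + 1) - q $ i" and ?b = "q $ (i + 2) - q $ i"
  have idx: "i + 1 + 1 = i + 2" "i + 1 + 2 = i" "i + 2 + 1 = i" "i + 2 + 2 = i + 1"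
    using exhaust_3[of i] by auto
  have "2 * (?a \<bullet> ?b) = (norm ?a)\<^sup>2 + (norm ?b)\<^sup>2 - (norm (q $ (i + 1) - q $ (i + 2)))\<^sup>2"
    unfolding power2_norm_eq_inner by (simp add: inner_simps inner_commute)
  also have "\<dots> = inertia q * (1 + side_axis (i + 2) \<bullet> shape_coords q +
      side_axis (i + 1) \<bullet> shape_coords q - side_axis i \<bullet> shape_coords q)"
    using side_sq[OF assms, of i] side_sq[OF assms, of "i + 1"] side_sq[OF assms, of "i + 2"]
    unfolding idx by (simp add: norm_minus_commute algebra_simps)
  also have "side_axis (i + 2) = - side_axis i - side_axis (i + 1)"
    using side_axis_sum[of i] by (simp add: eq_neg_iff_add_eq_0 algebra_simps)
  finally show ?thesis by (simp add: inner_simps algebra_simps)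
qed

lemma angle_compare:
  assumes q: "q \<in> labelled_triangles" and "\<not> collinear_triangle q"
  shows "pi / 2 < interior_angle q i \<longleftrightarrow> 1 / 2 < side_axis i \<bullet> shape_coords q"
    and "interior_angle q i < pi / 2 \<longleftrightarrow> side_axis i \<bullet> shape_coords q < 1 / 2"
proof -
  let ?a = "q $ (i + 1) - q $ i" and ?b = "q $ (i + 2) - q $ i"
  have "q $ 1 \<noteq> q $ 2" "q $ 2 \<noteq> q $ 3" "q $ 1 \<noteq> q $ 3"
    using assms(2) by (auto simp: collinear_triangle_def insert_commute)
  then have pos: "0 < norm ?a" "0 < norm ?b"
    using exhaust_3[of i] by auto
  define c where "c = (?a \<bullet> ?b) / (norm ?a * norm ?b)"
  have "\<bar>c\<bar> \<le> 1"
    using Cauchy_Schwarz_ineq2[of ?a ?b] pos by (simp add: c_def abs_mult)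
  then have c: "-1 \<le> c" "c \<le> 1" by auto
  have ang: "interior_angle q i = arccos c" by (simp add: interior_angle_def c_def Let_def)
  have "pi / 2 < arccos c \<longleftrightarrow> c < 0" "arccos c < pi / 2 \<longleftrightarrow> 0 < c"
    using c arccos_less_mono[of 0 c] arccos_less_mono[of c 0] by simp_all
  moreover have "c < 0 \<longleftrightarrow> ?a \<bullet> ?b < 0" "0 < c \<longleftrightarrow> 0 < ?a \<bullet> ?b"
    using mult_pos_pos[OF pos] unfolding c_def
    by (simp_all only: divide_less_0_iff zero_less_divide_iff) auto
  moreover have "?a \<bullet> ?b < 0 \<longleftrightarrow> 1 / 2 < side_axis i \<bullet> shape_coords q"
    "0 < ?a \<bullet> ?b \<longleftrightarrow> side_axis i \<bullet> shape_coords q < 1 / 2"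
    using inertia_pos[OF q] by (simp_all add: inner_at_vertex[OF q] mult_less_0_iff zero_less_mult_iff)
  ultimately show "pi / 2 < interior_angle q i \<longleftrightarrow> 1 / 2 < side_axis i \<bullet> shape_coords q"
    and "interior_angle q i < pi / 2 \<longleftrightarrow> side_axis i \<bullet> shape_coords q < 1 / 2"
    by (simp_all add: ang)
qed

lemma shape_coords_image:
  assumes "\<And>q. q \<in> labelled_triangles \<Longrightarrow> \<Phi> q \<longleftrightarrow> \<Psi> (shape_coords q)"
  shows "shape_coords ` {q \<in> labelled_triangles. \<Phi> q} = {P. norm P = 1 \<and> \<Psi> P}"
  using assms norm_shape_coords by (auto elim!: shape_coords_surj)

lemma isosceles_circle_eq:
  "isosceles_circle i = {P. norm P = 1 \<and> side_axis (i + 1) \<bullet> P = side_axis (i + 2) \<bullet> P}"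
  unfolding isosceles_circle_def shape_point_image
proof (rule shape_coords_image)
  fix q assume q: "q \<in> labelled_triangles"
  have idx: "i + 1 + 1 = i + 2" "i + 1 + 2 = i" "i + 2 + 1 = i" "i + 2 + 2 = i + 1"
    using exhaust_3[of i] by auto
  have "isosceles_with_apex i q \<longleftrightarrow>
      (norm (q $ i - q $ (i + 1)))\<^sup>2 = (norm (q $ (i + 2) - q $ i))\<^sup>2"
    by (simp add: isosceles_with_apex_def dist_norm norm_minus_commute)
  then show "isosceles_with_apex i q \<longleftrightarrow>
      side_axis (i + 1) \<bullet> shape_coords q = side_axis (i + 2) \<bullet> shape_coords q"
    using side_sq[OF q, of "i + 1"] side_sq[OF q, of "i + 2"] inertia_pos[OF q]
    unfolding idx by auto
qed

lemma obtuse_points: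
  "shape_point ` {s \<in> shapes. obtuse s} =
     {P. norm P = 1 \<and> P $ 2 \<noteq> 0 \<and> (\<exists>i. 1 / 2 < side_axis i \<bullet> P)}"
  unfolding obtuse_def shape_point_image
  by (rule shape_coords_image)
    (use angle_compare collinear_iff in \<open>auto simp: obtuse_triangle_def\<close>)

lemma acute_points:
  "shape_point ` {s \<in> shapes. acute s} =
     {P. norm P = 1 \<and> P $ 2 \<noteq> 0 \<and> (\<forall>i. side_axis i \<bullet> P < 1 / 2)}"
  unfolding acute_def shape_point_image
  by (rule shape_coords_image)
    (use angle_compare collinear_iff in \<open>auto simp: acute_triangle_def\<close>)

section \<open>The three isosceles circles\<close>

text \<open>The circle of apex \<open>i\<close> lies in the plane orthogonal to \<open>side_axis (i + 1) - side_axis (i + 2)\<close>,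
  of which the pole \<open>axis 2 1\<close> and \<open>side_axis i\<close> form an orthonormal basis.\<close>

lemma isosceles_circle_decomp:
  assumes "P \<in> isosceles_circle i"
  shows "P = P $ 2 *\<^sub>R axis 2 1 + (side_axis i \<bullet> P) *\<^sub>R side_axis i"
proof -
  have 3: "sqrt 3 * (sqrt 3 * x) = 3 * x" for x :: real by (simp flip: mult.assoc)
  have "i = 1 \<or> i = 2 \<or> i = 3" by (rule exhaust_3)
  moreover have "P $ 1 = sqrt 3 * P $ 3" if "sqrt 3 * P $ 1 = 3 * P $ 3"
  proof -
    have "sqrt 3 * P $ 1 = sqrt 3 * (sqrt 3 * P $ 3)" using that by (simp add: 3)
    then show ?thesis by simp
  qed
  moreover have "P $ 1 = - sqrt 3 * P $ 3" if "sqrt 3 * P $ 1 = - 3 * P $ 3"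
  proof -
    have "sqrt 3 * P $ 1 = sqrt 3 * (- sqrt 3 * P $ 3)" using that by (simp add: 3)
    then show ?thesis unfolding mult_cancel_left by simp
  qed
  ultimately show ?thesis using assms
    by (auto simp: isosceles_circle_eq side_axis_def inner_vec_def sum_3 vec_eq_iff forall_3
        axis_def field_simps 3)
qed

lemma isosceles_circle_frame: "great_circle_frame (isosceles_circle i) (axis 2 1, side_axis i)"
proof -
  have nrm: "norm (side_axis i) = 1" using inner_side_axis[of i i] by (simp add: norm_eq_1)
  have orth: "axis 2 1 \<bullet> side_axis j = 0" "side_axis j \<bullet> axis 2 1 = 0" for j
    by (simp_all add: inner_axis inner_axis' side_axis_def)
  have cyc: "i + 1 \<noteq> i" "i + 2 \<noteq> i" using exhaust_3[of i] by auto
  have "isosceles_circle i = range (great_circle_param (axis 2 1) (side_axis i))"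
  proof (intro equalityI subsetI)
    fix P assume P: "P \<in> isosceles_circle i"
    then have "P \<bullet> P = 1" by (simp add: isosceles_circle_eq norm_eq_1)
    moreover have "P \<bullet> P = (P $ 2)\<^sup>2 + (side_axis i \<bullet> P)\<^sup>2"
      by (subst (2) isosceles_circle_decomp[OF P])
        (simp add: inner_simps inner_axis power2_eq_square inner_commute)
    ultimately obtain t where "P $ 2 = cos t" "side_axis i \<bullet> P = sin t"
      using sincos_total_2pi[of "P $ 2" "side_axis i \<bullet> P"] by metis
    then show "P \<in> range (great_circle_param (axis 2 1) (side_axis i))"
      using isosceles_circle_decomp[OF P] by (auto simp: great_circle_param_def)
  next
    fix P assume "P \<in> range (great_circle_param (axis 2 1) (side_axis i))"
    then obtain t where t: "P = cos t *\<^sub>R axis 2 1 + sin t *\<^sub>R side_axis i"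
      by (auto simp: great_circle_param_def)
    have "P \<bullet> P = (cos t)\<^sup>2 + (sin t)\<^sup>2"
      by (simp add: t inner_simps orth inner_side_axis power2_eq_square
          inner_axis_axis)
    then have "norm P = 1" by (simp add: norm_eq_1)
    moreover have "side_axis (i + 1) \<bullet> P = side_axis (i + 2) \<bullet> P"
      using cyc by (simp add: t inner_simps orth inner_side_axis)
    ultimately show "P \<in> isosceles_circle i" by (simp add: isosceles_circle_eq)
  qed
  then show ?thesis by (simp add: great_circle_frame_def nrm orth)
qed

lemma side_axis_in_circle: "side_axis i \<in> isosceles_circle i"
proof -
  have "i + 1 \<noteq> i" "i + 2 \<noteq> i" using exhaust_3[of i] by auto
  then show ?thesis
    using inner_side_axis[of i i] by (simp add: isosceles_circle_eq norm_eq_1 inner_side_axis)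
qed

lemma isosceles_circle_arc_length:
  assumes "{c. Q c} \<in> sets borel"
    and "\<And>P. P \<in> isosceles_circle i \<Longrightarrow> side_axis i \<bullet> P \<notin> {-1, 0, 1 / 2, 1} \<Longrightarrow>
           P \<in> S \<longleftrightarrow> Q (side_axis i \<bullet> P)"
  shows "circle_arc_length (isosceles_circle i) S = measure lebesgue {t \<in> {-pi..<pi}. Q (cos t)}"
  using circle_arc_length_eq[OF isosceles_circle_frame side_axis_in_circle, of "{-1, 0, 1 / 2, 1}"]
    assms by blast

text \<open>The two inner products are equal on the circle, and together with \<open>side_axis i \<bullet> P\<close> they sum to
  zero.\<close>

lemma side_axis_on_circle:
  assumes P: "P \<in> isosceles_circle i" and "j \<noteq> i"
  shows "side_axis j \<bullet> P = - (side_axis i \<bullet> P) / 2"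
proof -
  have "side_axis i \<bullet> P + side_axis (i + 1) \<bullet> P + side_axis (i + 2) \<bullet> P = 0"
    using side_axis_sum[of i] by (metis inner_add_left inner_zero_left)
  moreover have "side_axis (i + 1) \<bullet> P = side_axis (i + 2) \<bullet> P"
    using P by (simp add: isosceles_circle_eq)
  moreover have "j = i + 1 \<or> j = i + 2"
    using exhaust_3[of i] exhaust_3[of j] \<open>j \<noteq> i\<close> by auto
  ultimately show ?thesis by auto
qed

lemma isosceles_circles_meet:
  assumes "P \<in> isosceles_circle i" "P \<in> isosceles_circle j" "j \<noteq> i"
  shows "side_axis i \<bullet> P = 0"
  using side_axis_on_circle[OF assms(1), of j] side_axis_on_circle[OF assms(2), of i] assms(3)
  by simp

lemma isosceles_collinear:
  assumes P: "P \<in> isosceles_circle i" and "P $ 2 = 0"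
  shows "side_axis i \<bullet> P \<in> {-1, 1}"
proof -
  have "P = (side_axis i \<bullet> P) *\<^sub>R side_axis i" using isosceles_circle_decomp[OF P] assms(2) by simp
  moreover have "norm P = 1" "norm (side_axis i) = 1"
    using P side_axis_in_circle[of i] by (auto simp: isosceles_circle_eq)
  ultimately have "\<bar>side_axis i \<bullet> P\<bar> = 1" by (metis mult.right_neutral norm_scaleR)
  then show ?thesis by auto
qed

lemma abs_side_axis_le:
  assumes "P \<in> isosceles_circle i"
  shows "\<bar>side_axis i \<bullet> P\<bar> \<le> 1"
  using Cauchy_Schwarz_ineq2[of "side_axis i" P] assms side_axis_in_circle[of i]
  by (simp add: isosceles_circle_eq)

lemma obtuse_on_circle:
  assumes P: "P \<in> isosceles_circle i" and c: "side_axis i \<bullet> P \<notin> {-1, 0, 1 / 2, 1}"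
  shows "P \<in> shape_point ` {s \<in> shapes. obtuse s} \<longleftrightarrow> 1 / 2 < side_axis i \<bullet> P"
proof -
  have "\<not> 1 / 2 < side_axis j \<bullet> P" if "j \<noteq> i" for j
    using side_axis_on_circle[OF P that] abs_side_axis_le[OF P] by (simp add: abs_le_iff)
  then have "(\<exists>j. 1 / 2 < side_axis j \<bullet> P) \<longleftrightarrow> 1 / 2 < side_axis i \<bullet> P" by metis
  moreover have "norm P = 1" "P $ 2 \<noteq> 0"
    using P isosceles_collinear[OF P] c by (auto simp: isosceles_circle_eq)
  ultimately show ?thesis by (simp add: obtuse_points)
qed

lemma acute_on_circle:
  assumes P: "P \<in> isosceles_circle i" and c: "side_axis i \<bullet> P \<notin> {-1, 0, 1 / 2, 1}"
  shows "P \<in> shape_point ` {s \<in> shapes. acute s} \<longleftrightarrow> side_axis i \<bullet> P < 1 / 2"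
proof -
  have "side_axis j \<bullet> P < 1 / 2" if "j \<noteq> i" for j
    using side_axis_on_circle[OF P that] abs_side_axis_le[OF P] c by (auto simp: abs_le_iff)
  then have "(\<forall>j. side_axis j \<bullet> P < 1 / 2) \<longleftrightarrow> side_axis i \<bullet> P < 1 / 2" by metis
  moreover have "norm P = 1" "P $ 2 \<noteq> 0"
    using P isosceles_collinear[OF P] c by (auto simp: isosceles_circle_eq)
  ultimately show ?thesis by (simp add: acute_points)
qed

text \<open>Since two circles meet only where \<open>side_axis i \<bullet> P = 0\<close>, removing the earlier circles from the
  later ones changes only a null set of parameters.\<close>

lemma isosceles_arc_length_eq:
  assumes Q: "{c. Q c} \<in> sets borel"
    and S: "\<And>i P. P \<in> isosceles_circle i \<Longrightarrow> side_axis i \<bullet> P \<notin> {-1, 0, 1 / 2, 1} \<Longrightarrow>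
           P \<in> S \<longleftrightarrow> Q (side_axis i \<bullet> P)"
  shows "isosceles_arc_length S = 3 * measure lebesgue {t \<in> {-pi..<pi}. Q (cos t)}"
proof -
  have "circle_arc_length (isosceles_circle i) (S - (\<Union>j\<in>J. isosceles_circle j)) =
      measure lebesgue {t \<in> {-pi..<pi}. Q (cos t)}" if "i \<notin> J" for i J
  proof (rule isosceles_circle_arc_length[OF Q])
    fix P assume P: "P \<in> isosceles_circle i" "side_axis i \<bullet> P \<notin> {-1, 0, 1 / 2, 1}"
    then have "P \<notin> (\<Union>j\<in>J. isosceles_circle j)"
      using isosceles_circles_meet[OF P(1)] that by auto
    then show "P \<in> S - (\<Union>j\<in>J. isosceles_circle j) \<longleftrightarrow> Q (side_axis i \<bullet> P)"
      using S[OF P] by simp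
  qed
  from this[of 1 "{}"] this[of 2 "{1}"] this[of 3 "{1, 2}"] show ?thesis
    by (simp add: isosceles_arc_length_def)
qed

theorem mainTheorem2:
  shows "prob_given_isosceles obtuse = 1 / 3 \<and> prob_given_isosceles acute = 2 / 3"
proof -
  have sub: "P \<in> isosceles_set" if "P \<in> isosceles_circle i" for P i
    using that unfolding isosceles_set_def by blast
  have "isosceles_arc_length isosceles_set = 3 * measure lebesgue {t \<in> {-pi..<pi}. True}"
    by (rule isosceles_arc_length_eq) (simp_all add: sub)
  also have "{t \<in> {-pi..<pi}. True} = {-pi..<pi}" by auto
  finally have total: "isosceles_arc_length isosceles_set = 3 * (2 * pi)" by simp
  have "isosceles_arc_length (shape_point ` {s \<in> shapes. obtuse s} \<inter> isosceles_set) =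
      3 * measure lebesgue {t \<in> {-pi..<pi}. 1 / 2 < cos t}"
  proof (rule isosceles_arc_length_eq)
    fix i P assume P: "P \<in> isosceles_circle i" "side_axis i \<bullet> P \<notin> {-1, 0, 1 / 2, 1}"
    show "P \<in> shape_point ` {s \<in> shapes. obtuse s} \<inter> isosceles_set \<longleftrightarrow> 1 / 2 < side_axis i \<bullet> P"
      unfolding Int_iff obtuse_on_circle[OF P] using sub[OF P(1)] by blast
  qed simp
  then have obt: "isosceles_arc_length (shape_point ` {s \<in> shapes. obtuse s} \<inter> isosceles_set) =
      3 * (2 * pi / 3)"
    unfolding measure_cos_gt_half .
  have "isosceles_arc_length (shape_point ` {s \<in> shapes. acute s} \<inter> isosceles_set) =
      3 * measure lebesgue {t \<in> {-pi..<pi}. cos t < 1 / 2}"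
  proof (rule isosceles_arc_length_eq)
    fix i P assume P: "P \<in> isosceles_circle i" "side_axis i \<bullet> P \<notin> {-1, 0, 1 / 2, 1}"
    show "P \<in> shape_point ` {s \<in> shapes. acute s} \<inter> isosceles_set \<longleftrightarrow> side_axis i \<bullet> P < 1 / 2"
      unfolding Int_iff acute_on_circle[OF P] using sub[OF P(1)] by blast
  qed simp
  then have acu: "isosceles_arc_length (shape_point ` {s \<in> shapes. acute s} \<inter> isosceles_set) =
      3 * (4 * pi / 3)"
    unfolding measure_cos_lt_half .
  show ?thesis by (simp add: prob_given_isosceles_def total obt acu)
qed

end
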